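(* Let $G$ be a chordal graph with $n$ vertices and leafage $\ell=\ell(G)$. Then the anchor width of $G$ is at most $n^{\ell}$.
   Context: All graphs are finite, simple and undirected. A graph is chordal if it has no induced cycle of length at least $4$; equivalently it is the intersection graph of a family of subtrees of a host tree (a subtree representation). The leafage $\ell(G)$ is the minimum number of leaves of a host tree over all subtree representations of $G$. For $W\subseteq V$ let $N_G^{\cap}(W)=\bigcap_{w\in W}N_G(w)$ (with $N_G^{\cap}(\emptyset)=V$) and $N_G^{\cup}(W)=\bigcup_{w\in W}N_G(w)$, where $N_G(w)$ is the set of neighbors of $w$. For a clique $C$, the periphery is $P_G(C)=N_G^{\cup}(C)\setminus C$; for $M\subseteq P_G(C)$ the anchor set is $A_G(M,C)=N_G^{\cap}(M)\cap C$ when non-empty; $\mathcal{A}_G(C)=\{A\subseteq C\mid A\neq\emptyset,\ \exists M\subseteq P_G(C): A=A_G(M,C)\}$. The anchor width of $G$ is the smallest $k$ such that $|\mathcal{A}_G(C)|\le k$ for every clique $C$ of $G$. *)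

theory Defs
  imports "Graph_Theory.Graph_Theory"
begin

text \<open>Finite simple undirected graphs are the symmetric digraphs of the locale \<^locale>\<open>graph\<close>
  (no loops, no parallel arcs); \<open>u \<rightarrow>\<^bsub>G\<^esub> v\<close> is adjacency.\<close>

definition neighbors :: "('a,'b) pre_digraph \<Rightarrow> 'a \<Rightarrow> 'a set" where
  "neighbors G w = {v. w \<rightarrow>\<^bsub>G\<^esub> v}"

definition induced_cycle :: "('a,'b) pre_digraph \<Rightarrow> 'a list \<Rightarrow> bool" where
  "induced_cycle G c \<longleftrightarrow> 3 \<le> length c \<and> distinct c \<and> set c \<subseteq> verts G \<and>
     (\<forall>i<length c. \<forall>j<length c.
        (c ! i \<rightarrow>\<^bsub>G\<^esub> c ! j) \<longleftrightarrow> j = Suc i mod length c \<or> i = Suc j mod length c)"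

definition chordal :: "('a,'b) pre_digraph \<Rightarrow> bool" where
  "chordal G \<longleftrightarrow> \<not> (\<exists>c. induced_cycle G c \<and> 4 \<le> length c)"

text \<open>The library predicate \<^const>\<open>tree\<close> does not fit symmetric digraphs: there every edge
  \<open>u\<close>--\<open>v\<close> already gives the directed cycle \<open>u, v, u\<close>. The cycles of the underlying undirected
  graph are the directed cycles of length at least 3. A tree has at least one vertex, since
  \<^const>\<open>connected\<close> excludes the null graph.\<close>

definition undirected_tree :: "('a,'b) pre_digraph \<Rightarrow> bool" where
  "undirected_tree T \<longleftrightarrow> graph T \<and> connected T \<and>
     \<not> (\<exists>p. pre_digraph.cycle T p \<and> 3 \<le> length p)"

text \<open>In a symmetric digraph the out-degree is the undirected degree. The one-vertex tree has no
  leaf, so complete graphs have leafage 0.\<close>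

definition leaves :: "('a,'b) pre_digraph \<Rightarrow> 'a set" where
  "leaves T = {x \<in> verts T. out_degree T x = 1}"

definition subtree_representation ::
    "('a,'b) pre_digraph \<Rightarrow> ('c,'d) pre_digraph \<Rightarrow> ('a \<Rightarrow> ('c,'d) pre_digraph) \<Rightarrow> bool" where
  "subtree_representation G T S \<longleftrightarrow> undirected_tree T \<and>
     (\<forall>v \<in> verts G. undirected_tree (S v) \<and> subgraph (S v) T) \<and>
     (\<forall>u \<in> verts G. \<forall>v \<in> verts G. u \<noteq> v \<longrightarrow>
        ((u \<rightarrow>\<^bsub>G\<^esub> v) \<longleftrightarrow> verts (S u) \<inter> verts (S v) \<noteq> {}))"

text \<open>Host trees are finite, so up to isomorphism their nodes are natural numbers and their arcs
  pairs of nodes. The set minimized over is non-empty exactly for chordal graphs.\<close>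

definition leafage :: "('a,'b) pre_digraph \<Rightarrow> nat" where
  "leafage G = (LEAST k. \<exists>(T :: (nat, nat \<times> nat) pre_digraph) S.
     subtree_representation G T S \<and> card (leaves T) = k)"

definition common_neighbors :: "('a,'b) pre_digraph \<Rightarrow> 'a set \<Rightarrow> 'a set" where
  "common_neighbors G W = verts G \<inter> (\<Inter>w\<in>W. neighbors G w)"

definition joint_neighbors :: "('a,'b) pre_digraph \<Rightarrow> 'a set \<Rightarrow> 'a set" where
  "joint_neighbors G W = (\<Union>w\<in>W. neighbors G w)"

definition clique :: "('a,'b) pre_digraph \<Rightarrow> 'a set \<Rightarrow> bool" where
  "clique G C \<longleftrightarrow> C \<subseteq> verts G \<and> (\<forall>u\<in>C. \<forall>v\<in>C. u \<noteq> v \<longrightarrow> u \<rightarrow>\<^bsub>G\<^esub> v)"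

definition periphery :: "('a,'b) pre_digraph \<Rightarrow> 'a set \<Rightarrow> 'a set" where
  "periphery G C = joint_neighbors G C - C"

definition anchor_set :: "('a,'b) pre_digraph \<Rightarrow> 'a set \<Rightarrow> 'a set \<Rightarrow> 'a set" where
  "anchor_set G M C = common_neighbors G M \<inter> C"

definition anchor_sets :: "('a,'b) pre_digraph \<Rightarrow> 'a set \<Rightarrow> 'a set set" where
  "anchor_sets G C = {A. A \<subseteq> C \<and> A \<noteq> {} \<and> (\<exists>M \<subseteq> periphery G C. A = anchor_set G M C)}"

definition anchor_width :: "('a,'b) pre_digraph \<Rightarrow> nat" where
  "anchor_width G = (LEAST k. \<forall>C. clique G C \<longrightarrow> card (anchor_sets G C) \<le> k)"

end

theory Submission
  imports Defs
begin

text \<open>Fix a representation of \<open>G\<close> by subtrees of a tree \<open>T\<close> with \<open>\<ell>\<close> leaves. By the Helly property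
  the subtrees of a clique \<open>C\<close> share a node \<open>r\<close>, at which we root \<open>T\<close>. A vertex \<open>v\<close> outside \<open>C\<close> is
  adjacent to \<open>c \<in> C\<close> iff the topmost node of the subtree of \<open>v\<close> lies in the subtree of \<open>c\<close>, and the
  latter is closed under ancestors. Hence, for every leaf, only the member of \<open>M\<close> whose topmost node
  is deepest on the path from \<open>r\<close> to that leaf matters for the anchor set of \<open>M\<close>; one choice of a
  vertex (or of none) per leaf determines the anchor set. That the leafage is attained at all rests
  on the existence of a subtree representation, obtained by repeatedly removing a simplicial vertex
  and reinserting it as a new leaf of the host tree.\<close>

section \<open>Chordless paths\<close>

text \<open>Walks are vertex lists over an arbitrary relation, confined to a set \<open>X\<close>,
  so that one notion serves both host trees and chordal graphs.\<close>

definition walk_in :: "('a \<Rightarrow> 'a \<Rightarrow> bool) \<Rightarrow> 'a set \<Rightarrow> 'a \<Rightarrow> 'a list \<Rightarrow> 'a \<Rightarrow> bool" where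
  "walk_in adj X u p v \<longleftrightarrow>
     p \<noteq> [] \<and> hd p = u \<and> last p = v \<and> set p \<subseteq> X \<and> successively adj p"

lemma walk_in_exists:
  assumes "(u, v) \<in> rtrancl_on X {(a, b). adj a b}"
  shows "\<exists>p. walk_in adj X u p v"
  using assms
proof (induct rule: rtrancl_on_induct)
  case base
  then have "walk_in adj X u [u] u" by (simp add: walk_in_def)
  then show ?case by blast
next
  case (step y z)
  then obtain p where "walk_in adj X u p y" by blast
  with step have "walk_in adj X u (p @ [z]) z"
    by (auto simp: walk_in_def successively_append_iff)
  then show ?case by blast
qed

lemma walk_in_splice:
  assumes "walk_in adj X u (as @ bs @ cs) v" "as \<noteq> []" "cs \<noteq> []" "adj (last as) (hd cs)"
  shows "walk_in adj X u (as @ cs) v"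
  using assms by (auto simp: walk_in_def successively_append_iff)

text \<open>A shortest walk works: cutting out the loop between two occurrences of a vertex, or
  taking a chord, would give a shorter one.\<close>

lemma chordless_path:
  assumes "(u, v) \<in> rtrancl_on X {(a, b). adj a b}"
  obtains p where "walk_in adj X u p v" "distinct p"
    "\<And>i j. Suc i < j \<Longrightarrow> j < length p \<Longrightarrow> \<not> adj (p ! i) (p ! j)"
proof -
  obtain p where p: "walk_in adj X u p v"
    and least: "\<And>q. walk_in adj X u q v \<Longrightarrow> length p \<le> length q"
    using walk_in_exists[OF assms] ex_has_least_nat[of "\<lambda>p. walk_in adj X u p v" _ length]
    by blast
  have "distinct p"
  proof (rule ccontr)
    assume "\<not> distinct p"
    then obtain as bs cs x where "p = as @ [x] @ bs @ [x] @ cs"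
      using not_distinct_decomp by blast
    moreover from this p have "walk_in adj X u (as @ [x] @ cs) v"
      by (cases cs)
        (auto simp: walk_in_def successively_append_iff successively_Cons hd_append
          split: if_splits)
    ultimately show False using least by fastforce
  qed
  moreover have False if "Suc i < j" "j < length p" "adj (p ! i) (p ! j)" for i j
  proof -
    \<comment> \<open>The stretch strictly between positions \<open>i\<close> and \<open>j\<close>.
      It is non-empty because \<open>Suc i < j\<close>, so dropping it shortens the walk.\<close>
    define bs where "bs = drop (Suc i) (take j p)"
    have "take j p = take (Suc i) p @ bs"
      unfolding bs_def using that(1) by (metis append_take_drop_id less_or_eq_imp_le min_def take_take)
    then have eq: "p = take (Suc i) p @ bs @ drop j p"
      by (metis append.assoc append_take_drop_id)
    have "walk_in adj X u (take (Suc i) p @ drop j p) v"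
      using that p walk_in_splice[of adj X u "take (Suc i) p" bs "drop j p" v] eq
      by (simp add: hd_drop_conv_nth last_conv_nth walk_in_def)
    from least[OF this] that show False by simp
  qed
  ultimately show thesis using p that by blast
qed

section \<open>Trees given by a parent function\<close>

lemma finite_ex_max_nat:
  fixes f :: "'a \<Rightarrow> nat"
  assumes "finite A" "A \<noteq> {}"
  shows "\<exists>x\<in>A. \<forall>y\<in>A. f y \<le> f x"
proof -
  have "Max (f ` A) \<in> f ` A" using assms by simp
  then obtain x where "x \<in> A" "f x = Max (f ` A)" by auto
  then show ?thesis using assms(1) by (intro bexI[of _ x]) auto
qed

text \<open>\<open>depth\<close> is any measure that drops from child to parent, not necessarily the
  distance to the root. Thus breadth-first levels qualify, and so does \<open>id\<close> when
  parents are smaller numbers.\<close>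

locale rooted_tree =
  fixes V :: "'a set" and r :: 'a and par :: "'a \<Rightarrow> 'a" and depth :: "'a \<Rightarrow> nat"
  assumes finite_V: "finite V"
    and root_in: "r \<in> V"
    and par_in: "x \<in> V \<Longrightarrow> x \<noteq> r \<Longrightarrow> par x \<in> V"
    and depth_par: "x \<in> V \<Longrightarrow> x \<noteq> r \<Longrightarrow> depth (par x) < depth x"
begin

definition up :: "('a \<times> 'a) set" where
  "up = {(x, par x) | x. x \<in> V \<and> x \<noteq> r}"

text \<open>A connected node set with topmost node \<open>t\<close>. The conjunct
  \<open>x \<noteq> r\<close> keeps the meaningless \<open>par r\<close> out and forces
  \<open>t = r\<close> once \<open>r\<close> is in \<open>X\<close>.\<close>

definition subtree_at :: "'a set \<Rightarrow> 'a \<Rightarrow> bool" where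
  "subtree_at X t \<longleftrightarrow> X \<subseteq> V \<and> t \<in> X \<and> (\<forall>x\<in>X. x \<noteq> t \<longrightarrow> x \<noteq> r \<and> par x \<in> X)"

lemma in_up_iff: "(x, y) \<in> up \<longleftrightarrow> x \<in> V \<and> x \<noteq> r \<and> y = par x"
  by (auto simp: up_def)

lemma up_rtrancl_depth: "(x, y) \<in> up\<^sup>* \<Longrightarrow> x = y \<or> depth y < depth x"
  by (induct rule: rtrancl_induct) (use depth_par in \<open>force simp: in_up_iff\<close>)+

lemma up_linear: "(x, a) \<in> up\<^sup>* \<Longrightarrow> (x, b) \<in> up\<^sup>* \<Longrightarrow> (a, b) \<in> up\<^sup>* \<or> (b, a) \<in> up\<^sup>*"
  by (rule single_valued_confluent) (auto simp: single_valued_def in_up_iff)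

lemma subtree_at_V: "subtree_at V r"
  by (auto simp: subtree_at_def root_in par_in)

lemma subtree_at_root: "subtree_at X t \<Longrightarrow> r \<in> X \<Longrightarrow> t = r"
  by (auto simp: subtree_at_def)

lemma subtree_at_up_top:
  assumes "subtree_at X t" "x \<in> X"
  shows "(x, t) \<in> up\<^sup>*"
  using assms(2)
proof (induct "depth x" arbitrary: x rule: less_induct)
  case less
  show ?case
  proof (cases "x = t")
    case False
    with less(2) assms(1) have "x \<in> V" "x \<noteq> r" "par x \<in> X" by (auto simp: subtree_at_def)
    then have "(x, par x) \<in> up" "(par x, t) \<in> up\<^sup>*"
      using less(1)[of "par x"] depth_par by (auto simp: in_up_iff)
    then show ?thesis by (rule converse_rtrancl_into_rtrancl)
  qed simp
qed

lemma subtree_at_convex: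
  assumes "subtree_at X t" "x \<in> X" "(x, a) \<in> up\<^sup>*" "(a, t) \<in> up\<^sup>*"
  shows "a \<in> X"
  using assms(3,4)
proof (induct rule: rtrancl_induct)
  case base
  show ?case by (fact assms(2))
next
  case (step y z)
  then have "y \<in> X" by (meson converse_rtrancl_into_rtrancl)
  \<comment> \<open>\<open>z\<close> is strictly above \<open>y\<close> while \<open>t\<close> is at
    or above \<open>z\<close>; hence \<open>y\<close> is not yet \<open>t\<close> and its parent
    stays in \<open>X\<close>.\<close>
  have "depth z < depth y" using step(2) depth_par by (auto simp: in_up_iff)
  with up_rtrancl_depth[OF step(4)] have "y \<noteq> t" by auto
  with \<open>y \<in> X\<close> step(2) assms(1) show ?case by (auto simp: subtree_at_def in_up_iff)
qed

text \<open>The deepest of the topmost nodes is common to all: for a node shared by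
  \<open>S i\<close> and \<open>S j\<close>, both tops are ancestors of it, so the deeper top
  \<open>t i\<close> lies between that node and \<open>t j\<close>, and convexity of
  \<open>S j\<close> applies.\<close>

lemma helly:
  assumes "finite I" "I \<noteq> {}"
    and sub: "\<And>i. i \<in> I \<Longrightarrow> subtree_at (S i) (t i)"
    and meet: "\<And>i j. i \<in> I \<Longrightarrow> j \<in> I \<Longrightarrow> S i \<inter> S j \<noteq> {}"
  shows "\<exists>x\<in>V. \<forall>i\<in>I. x \<in> S i"
proof -
  obtain i where i: "i \<in> I" and deepest: "\<And>j. j \<in> I \<Longrightarrow> depth (t j) \<le> depth (t i)"
    using finite_ex_max_nat[OF assms(1,2), of "depth \<circ> t"] by auto
  have "t i \<in> S j" if j: "j \<in> I" for j
  proof -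
    obtain x where x: "x \<in> S i" "x \<in> S j" using meet[OF i j] by blast
    then have "(x, t i) \<in> up\<^sup>*" "(x, t j) \<in> up\<^sup>*"
      using sub i j by (auto intro: subtree_at_up_top)
    moreover from this have "(t i, t j) \<in> up\<^sup>*"
      using up_linear up_rtrancl_depth[of "t j" "t i"] deepest[OF j]
      by (metis not_le rtrancl.rtrancl_refl)
    ultimately show ?thesis using sub[OF j] x(2) subtree_at_convex by blast
  qed
  moreover have "t i \<in> V" using sub[OF i] by (auto simp: subtree_at_def)
  ultimately show ?thesis by blast
qed

lemma subtree_at_root_closed:
  assumes "subtree_at X r" "x \<in> X" "(x, a) \<in> up\<^sup>*"
  shows "a \<in> X"
proof -
  have "x \<in> V" using assms by (auto simp: subtree_at_def)
  with assms(3) have "a \<in> V" by (induct rule: rtrancl_induct) (auto simp: in_up_iff par_in)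
  then have "(a, r) \<in> up\<^sup>*" by (rule subtree_at_up_top[OF subtree_at_V])
  with assms show ?thesis by (blast intro: subtree_at_convex)
qed

text \<open>A common node has \<open>t\<close> as an ancestor, and \<open>X\<close>, containing the
  root, is closed under ancestors. Intersection thus becomes a test of a single node.\<close>

lemma subtree_at_meets_iff:
  assumes "subtree_at X r" "subtree_at Y t"
  shows "X \<inter> Y \<noteq> {} \<longleftrightarrow> t \<in> X"
  using assms subtree_at_root_closed[OF assms(1)] subtree_at_up_top[OF assms(2)]
  by (auto simp: subtree_at_def)

lemma childless_below:
  assumes "x \<in> V"
  obtains y where "y \<in> V" "(y, x) \<in> up\<^sup>*" "\<And>z. (z, y) \<notin> up"
proof -
  let ?D = "{y \<in> V. (y, x) \<in> up\<^sup>*}"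
  have "finite ?D" "x \<in> ?D" using assms finite_V by auto
  then obtain y where y: "y \<in> ?D" and deepest: "\<And>z. z \<in> ?D \<Longrightarrow> depth z \<le> depth y"
    using finite_ex_max_nat[of ?D depth] by blast
  have "(z, y) \<notin> up" for z
  proof
    assume z: "(z, y) \<in> up"
    with y have "z \<in> ?D" by (auto simp: in_up_iff intro: converse_rtrancl_into_rtrancl)
    with deepest[OF this] z depth_par[of z] show False by (auto simp: in_up_iff)
  qed
  with y that show thesis by blast
qed

text \<open>The top is a node of least depth. Along a path in \<open>X\<close> starting there, every
  node reached can climb back to the top inside \<open>X\<close>.\<close>

lemma connected_subtree_at:
  assumes "X \<subseteq> V" "X \<noteq> {}"
    and conn: "\<And>u v. u \<in> X \<Longrightarrow> v \<in> X \<Longrightarrow> (u, v) \<in> rtrancl_on X (up \<union> up\<inverse>)"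
  shows "\<exists>t. subtree_at X t"
proof -
  obtain t where t: "t \<in> X" and highest: "\<And>x. x \<in> X \<Longrightarrow> depth t \<le> depth x"
    using ex_has_least_nat[of "\<lambda>x. x \<in> X" _ depth] assms(2) by blast
  have not_above: "(t, z) \<notin> up" if "z \<in> X" for z
    using highest[OF that] depth_par[of t] by (auto simp: in_up_iff)
  have chain: "(x, t) \<in> (up \<inter> X \<times> X)\<^sup>*" if "x \<in> X" for x
    using conn[OF t that]
  proof (induct rule: rtrancl_on_induct)
    case (step y z)
    show ?case
    proof (cases "(z, y) \<in> up")
      case True
      with step show ?thesis by (auto intro: converse_rtrancl_into_rtrancl)
    next
      \<comment> \<open>An upward step: the chain from \<open>y\<close> begins with its parent
        \<open>z\<close>, so the rest of it is a chain from \<open>z\<close>.\<close>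
      case False
      with step have "(y, z) \<in> up" by auto
      with not_above step have "y \<noteq> t" by blast
      with step(5) obtain w where "(y, w) \<in> up" "(w, t) \<in> (up \<inter> X \<times> X)\<^sup>*"
        by (auto elim: converse_rtranclE)
      with \<open>(y, z) \<in> up\<close> show ?thesis by (simp add: in_up_iff)
    qed
  qed simp
  have "x \<noteq> r \<and> par x \<in> X" if "x \<in> X" "x \<noteq> t" for x
    using chain[OF that(1)] that(2) by (auto simp: in_up_iff elim: converse_rtranclE)
  with t assms(1) show ?thesis by (auto simp: subtree_at_def)
qed

end

section \<open>Undirected trees as parent-function trees\<close>

context graph
begin

lemma dominates_commute: "u \<rightarrow>\<^bsub>G\<^esub> v \<longleftrightarrow> v \<rightarrow>\<^bsub>G\<^esub> u"
  using arcs_ends_symmetric[OF sym_arcs] by blast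

lemma dominates_irrefl: "\<not> u \<rightarrow>\<^bsub>G\<^esub> u"
  using adj_not_same by blast

end

section \<open>Cycles as lists of distinct vertices\<close>

context wf_digraph
begin

lemma awalk_of_successively:
  assumes "successively (dominates G) (u # vs)" "u \<in> verts G"
  shows "\<exists>p. awalk u p (last (u # vs)) \<and> awalk_verts u p = u # vs"
  using assms
proof (induct vs arbitrary: u)
  case Nil
  then have "awalk u [] u \<and> awalk_verts u [] = [u]" by (simp add: awalk_Nil_iff)
  then show ?case by auto
next
  case (Cons v vs)
  then obtain e where e: "e \<in> arcs G" "tail G e = u" "head G e = v" by auto
  moreover have "v \<in> verts G" using e by auto
  with Cons obtain p where "awalk v p (last (v # vs))" "awalk_verts v p = v # vs" by force
  ultimately have "awalk u (e # p) (last (u # v # vs)) \<and> awalk_verts u (e # p) = u # v # vs"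
    by (simp add: awalk_Cons_iff)
  then show ?case by blast
qed

lemma successively_awalk_verts:
  "awalk u p v \<Longrightarrow> successively (dominates G) (awalk_verts u p)"
proof (induct p arbitrary: u)
  case (Cons e p)
  then have e: "e \<in> arcs G" "awalk (head G e) p v" by (auto simp: awalk_Cons_iff)
  then have "tail G e \<rightarrow>\<^bsub>G\<^esub> head G e" by (auto simp: arcs_ends_conv)
  with Cons(1)[OF e(2)] e(2) show ?case by (simp add: successively_Cons)
qed simp

lemma ex_cycle_iff:
  "(\<exists>p. cycle p \<and> 3 \<le> length p) \<longleftrightarrow>
   (\<exists>c. distinct c \<and> 3 \<le> length c \<and> successively (dominates G) c \<and> last c \<rightarrow>\<^bsub>G\<^esub> hd c)"
  (is "?L \<longleftrightarrow> ?R")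
proof
  assume ?L
  then obtain p u where p: "3 \<le> length p" "awalk u p u" "distinct (tl (awalk_verts u p))"
    by (auto simp: cycle_def)
  obtain c where c: "awalk_verts u p = u # c"
    using p(2) by (metis awalk_verts_non_Nil awhd_of_awalk list.collapse)
  have "length c = length p" using c length_awalk_verts[of u p] by simp
  moreover from this have "c \<noteq> []" using p(1) by auto
  moreover have "last c = u" using awlast_of_awalk[OF p(2)] c \<open>c \<noteq> []\<close> by simp
  ultimately show ?R
    using successively_awalk_verts[OF p(2)] p c by (auto simp: successively_Cons)
next
  assume ?R
  then obtain c where c: "distinct c" "3 \<le> length c" "successively (dominates G) c"
    "last c \<rightarrow>\<^bsub>G\<^esub> hd c" by blast
  \<comment> \<open>Putting the last vertex in front closes the list into a walk; the distinct tail
    demanded by \<open>cycle\<close> is then \<open>c\<close> itself.\<close>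
  then have "successively (dominates G) (last c # c)" by (cases c) auto
  moreover have "last c \<in> verts G" using c(4) by (rule adj_in_verts)
  ultimately obtain p where p: "awalk (last c) p (last (last c # c))"
    "awalk_verts (last c) p = last c # c"
    using awalk_of_successively by blast
  moreover have "length p = length c" using p(2) length_awalk_verts[of "last c" p] by simp
  moreover have "last (last c # c) = last c" using c(2) by auto
  ultimately have "cycle p \<and> 3 \<le> length p" using c by (auto simp: cycle_def)
  then show ?L by blast
qed

end

lemma undirected_tree_reachable:
  assumes "undirected_tree T" "u \<in> verts T" "v \<in> verts T"
  shows "(u, v) \<in> rtrancl_on (verts T) (arcs_ends T)"
proof -
  interpret graph T using assms by (simp add: undirected_tree_def)
  have "strongly_connected T"
    using symmetric_connected_imp_strongly_connected assms sym_arcs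
    by (auto simp: undirected_tree_def)
  with assms show ?thesis by (auto simp: strongly_connected_def reachable_def)
qed

section \<open>Breadth-first rooting of an undirected tree\<close>

locale bfs_tree = graph T for T :: "('a, 'b) pre_digraph" (structure) +
  fixes r :: 'a
  assumes tree: "undirected_tree T"
    and root: "r \<in> verts T"
begin

definition level :: "'a \<Rightarrow> nat" where
  "level x = (LEAST n. (r, x) \<in> arcs_ends T ^^ n)"

definition parent :: "'a \<Rightarrow> 'a" where
  "parent x = (SOME y. y \<rightarrow>\<^bsub>T\<^esub> x \<and> level y < level x)"

lemma level_path:
  assumes "x \<in> verts T"
  shows "(r, x) \<in> arcs_ends T ^^ level x"
proof -
  have "(r, x) \<in> (arcs_ends T)\<^sup>*"
    using undirected_tree_reachable[OF tree root assms] by (rule rtrancl_on_rtranclI)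
  then obtain n where "(r, x) \<in> arcs_ends T ^^ n" by (auto simp: rtrancl_power)
  then show ?thesis unfolding level_def by (rule LeastI)
qed

lemma ex_parent:
  assumes "x \<in> verts T" "x \<noteq> r"
  shows "\<exists>y. y \<rightarrow>\<^bsub>T\<^esub> x \<and> level y < level x"
proof (cases "level x")
  case 0
  with level_path[OF assms(1)] assms(2) show ?thesis by simp
next
  case (Suc n)
  with level_path[OF assms(1)] obtain y where "(r, y) \<in> arcs_ends T ^^ n" "y \<rightarrow>\<^bsub>T\<^esub> x"
    by auto
  moreover from this have "level y \<le> n" by (auto simp: level_def intro: Least_le)
  ultimately show ?thesis using Suc by auto
qed

lemma parent: "x \<in> verts T \<Longrightarrow> x \<noteq> r \<Longrightarrow> parent x \<rightarrow>\<^bsub>T\<^esub> x \<and> level (parent x) < level x"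
  unfolding parent_def by (rule someI_ex) (rule ex_parent)

text \<open>Climbing parents from \<open>y\<close> only visits levels strictly below that of
  \<open>x\<close> after the start, so \<open>x\<close> is never met.\<close>

lemma reaches_root_avoiding:
  assumes "y \<in> verts T" "y \<noteq> x" "level y \<le> level x"
  shows "(y, r) \<in> rtrancl_on (verts T - {x}) (arcs_ends T)"
  using assms
proof (induct "level y" arbitrary: y rule: less_induct)
  case less
  show ?case
  proof (cases "y = r")
    case True
    then show ?thesis using less by auto
  next
    case False
    note p = parent[OF less(2) False]
    with less have "parent y \<in> verts T" "parent y \<noteq> x" by (auto dest: adj_in_verts)
    then have "(parent y, r) \<in> rtrancl_on (verts T - {x}) (arcs_ends T)"
      using less p by simp
    then show ?thesis using p less dominates_commute
      by (intro converse_rtrancl_on_into_rtrancl_on[of y "parent y"]) auto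
  qed
qed

text \<open>Two neighbours of \<open>x\<close> not below \<open>x\<close> would be joined through the root by a path avoiding
  \<open>x\<close>, which closes to a cycle at \<open>x\<close>.\<close>

lemma unique_upper_neighbour:
  assumes "x \<rightarrow>\<^bsub>T\<^esub> y" "x \<rightarrow>\<^bsub>T\<^esub> z" "level y \<le> level x" "level z \<le> level x"
  shows "y = z"
proof (rule ccontr)
  assume "y \<noteq> z"
  have yz: "y \<in> verts T" "z \<in> verts T" "y \<noteq> x" "z \<noteq> x"
    using assms adj_in_verts adj_not_same by blast+
  have "sym (rtrancl_on (verts T - {x}) (arcs_ends T))"
    using sym_arcs unfolding symmetric_def by (rule rtrancl_on_sym)
  then have "(y, z) \<in> rtrancl_on (verts T - {x}) (arcs_ends T)"
    using reaches_root_avoiding[OF yz(1,3) assms(3)] reaches_root_avoiding[OF yz(2,4) assms(4)]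
    by (meson rtrancl_on_trans symD)
  then obtain p where p: "walk_in (dominates T) (verts T - {x}) y p z" "distinct p"
    using chordless_path[of y z "verts T - {x}" "dominates T"] by simp blast
  have "length p \<ge> 2"
    using p \<open>y \<noteq> z\<close> by (cases p; cases "tl p") (auto simp: walk_in_def)
  with p have "distinct (x # p)" "3 \<le> length (x # p)" "successively (dominates T) (x # p)"
    "last (x # p) \<rightarrow>\<^bsub>T\<^esub> hd (x # p)"
    using assms dominates_commute by (auto simp: walk_in_def successively_Cons)
  then have "\<exists>p. cycle p \<and> 3 \<le> length p" using ex_cycle_iff by blast
  with tree show False by (simp add: undirected_tree_def)
qed

sublocale rooted_tree "verts T" r parent level
  using parent root by unfold_locales (auto dest: adj_in_verts)

text \<open>\<open>unique_upper_neighbour\<close> identifies \<open>y\<close> with the parent of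
  \<open>x\<close>; in particular no edge joins two nodes of equal level.\<close>

lemma adj_imp_up:
  assumes "x \<rightarrow>\<^bsub>T\<^esub> y" "level y \<le> level x"
  shows "(x, y) \<in> up"
proof -
  have xy: "x \<in> verts T" "y \<in> verts T" "x \<noteq> y" using assms adj_in_verts adj_not_same by blast+
  have "x \<noteq> r"
  proof
    assume "x = r"
    then have "level x = 0" by (simp add: level_def)
    with assms level_path[OF xy(2)] \<open>x = r\<close> xy(3) show False by simp
  qed
  note p = parent[OF xy(1) this]
  then have "x \<rightarrow>\<^bsub>T\<^esub> parent x" using dominates_commute by blast
  from unique_upper_neighbour[OF assms(1) this assms(2)] p have "y = parent x" by simp
  with xy(1) \<open>x \<noteq> r\<close> show ?thesis by (simp add: in_up_iff)
qed

lemma arcs_ends_eq: "arcs_ends T = up \<union> up\<inverse>"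
proof -
  have "(x, y) \<in> up \<union> up\<inverse>" if "x \<rightarrow>\<^bsub>T\<^esub> y" for x y
    using that adj_imp_up[of x y] adj_imp_up[of y x] dominates_commute by (cases "level y \<le> level x") auto
  moreover have "x \<rightarrow>\<^bsub>T\<^esub> y" "y \<rightarrow>\<^bsub>T\<^esub> x" if "(x, y) \<in> up" for x y
    using that parent dominates_commute by (auto simp: in_up_iff)
  ultimately show ?thesis by auto
qed

lemma subgraph_subtree_at:
  assumes "undirected_tree H" "subgraph H T"
  shows "\<exists>t. subtree_at (verts H) t"
proof (rule connected_subtree_at)
  show "verts H \<subseteq> verts T" using assms(2) by (auto simp: subgraph_def)
  show "verts H \<noteq> {}"
    using assms(1) by (auto simp: undirected_tree_def connected_def strongly_connected_def)
  have "arcs_ends H \<subseteq> arcs_ends T"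
    using assms(2) by (auto simp: subgraph_def compatible_def arcs_ends_conv)
  then show "(u, v) \<in> rtrancl_on (verts H) (up \<union> up\<inverse>)" if "u \<in> verts H" "v \<in> verts H" for u v
    using rtrancl_on_mono[OF _ order_refl undirected_tree_reachable[OF assms(1) that]]
    by (simp add: arcs_ends_eq)
qed

text \<open>A childless descendant of \<open>x\<close> is not the root, so its parent is its only
  neighbour.\<close>

lemma leaf_below:
  assumes "x \<in> verts T" "x \<noteq> r"
  obtains l where "l \<in> leaves T" "(l, x) \<in> up\<^sup>*"
proof -
  obtain l where l: "l \<in> verts T" "(l, x) \<in> up\<^sup>*" "\<And>z. (z, l) \<notin> up"
    using childless_below[OF assms(1)] by blast
  have "l \<noteq> r" using l(2) assms(2) by (auto simp: in_up_iff elim: converse_rtranclE)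
  then have nb: "l \<rightarrow>\<^bsub>T\<^esub> z \<longleftrightarrow> z = parent l" for z
    using l(1,3) by (auto simp: arcs_ends_eq in_up_iff)
  then obtain e where e: "e \<in> arcs T" "tail T e = l" "head T e = parent l" by blast
  \<comment> \<open>The out-degree counts arcs, so having one neighbour gives degree 1 only because
    there are no parallel arcs.\<close>
  have "out_arcs T l = {e}"
  proof -
    have "e' = e" if "e' \<in> arcs T" "tail T e' = l" for e'
    proof -
      have "l \<rightarrow>\<^bsub>T\<^esub> head T e'" using that by (auto simp: arcs_ends_conv)
      then show ?thesis using that e nb by (intro no_multi_arcs) (auto simp: arc_to_ends_def)
    qed
    with e show ?thesis unfolding out_arcs_def by blast
  qed
  with l(1) have "l \<in> leaves T" by (simp add: leaves_def out_degree_def)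
  with l(2) that show thesis by blast
qed

end

section \<open>Counting anchor sets in a subtree representation\<close>

lemma subtree_representation_adj_iff:
  assumes "subtree_representation G T S" "u \<in> verts G" "v \<in> verts G" "u \<noteq> v"
  shows "u \<rightarrow>\<^bsub>G\<^esub> v \<longleftrightarrow> verts (S u) \<inter> verts (S v) \<noteq> {}"
  using assms by (simp add: subtree_representation_def)

lemma clique_common_node:
  assumes "graph G" "subtree_representation G T S" "clique G C" "C \<noteq> {}"
  shows "\<exists>r\<in>verts T. \<forall>c\<in>C. r \<in> verts (S c)"
proof -
  interpret G: graph G by fact
  have T: "undirected_tree T" and C: "C \<subseteq> verts G"
    and S: "\<And>v. v \<in> verts G \<Longrightarrow> undirected_tree (S v) \<and> subgraph (S v) T"
    using assms by (auto simp: subtree_representation_def clique_def)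
  obtain r where "r \<in> verts T"
    using T by (auto simp: undirected_tree_def connected_def strongly_connected_def)
  \<comment> \<open>Any root will do here, since it only serves to apply \<open>helly\<close>; for
    the counting, the tree is rooted anew at the common node found.\<close>
  then interpret bfs_tree T r
    using T by (auto simp: bfs_tree_def bfs_tree_axioms_def undirected_tree_def)
  have "\<forall>v\<in>verts G. \<exists>t. subtree_at (verts (S v)) t"
    using S subgraph_subtree_at by blast
  from bchoice[OF this] obtain t
    where t: "\<And>v. v \<in> verts G \<Longrightarrow> subtree_at (verts (S v)) (t v)" by blast
  show ?thesis
  proof (rule helly)
    show "finite C" using C G.finite_verts by (rule finite_subset)
    show "subtree_at (verts (S c)) (t c)" if "c \<in> C" for c using t C that by auto
    show "verts (S c) \<inter> verts (S c') \<noteq> {}" if "c \<in> C" "c' \<in> C" for c c'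
    proof (cases "c = c'")
      case True
      then show ?thesis using t[of c] C that by (auto simp: subtree_at_def)
    next
      case False
      with assms(3) that have "c \<rightarrow>\<^bsub>G\<^esub> c'" by (auto simp: clique_def)
      with subtree_representation_adj_iff[OF assms(2)] C that False show ?thesis by blast
    qed
  qed fact
qed

lemma card_anchor_sets_le:
  assumes "graph G" "subtree_representation G T S" "clique G C"
  shows "card (anchor_sets G C) \<le> card (verts G) ^ card (leaves T)"
proof (cases "C = {}")
  case True
  then have "anchor_sets G C = {}" by (auto simp: anchor_sets_def)
  then show ?thesis by simp
next
  case False
  then obtain c0 where c0: "c0 \<in> C" by blast
  interpret G: graph G by fact
  have T: "undirected_tree T" and C: "C \<subseteq> verts G"
    and S: "\<And>v. v \<in> verts G \<Longrightarrow> undirected_tree (S v) \<and> subgraph (S v) T"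
    using assms by (auto simp: subtree_representation_def clique_def)
  obtain r where r: "r \<in> verts T" "\<And>c. c \<in> C \<Longrightarrow> r \<in> verts (S c)"
    using clique_common_node[OF assms False] by blast
  then interpret bfs_tree T r
    using T by (auto simp: bfs_tree_def bfs_tree_axioms_def undirected_tree_def)
  have "\<forall>v\<in>verts G. \<exists>t. subtree_at (verts (S v)) t"
    using S subgraph_subtree_at by blast
  from bchoice[OF this] obtain t
    where t: "\<And>v. v \<in> verts G \<Longrightarrow> subtree_at (verts (S v)) (t v)" by blast
  \<comment> \<open>All clique subtrees contain the root, hence have it as top and are closed under
    ancestors.\<close>
  have Sc: "subtree_at (verts (S c)) r" if "c \<in> C" for c
    using t[of c] subtree_at_root[of "verts (S c)" "t c"] r(2) C that by auto
  have adj_iff: "v \<rightarrow>\<^bsub>G\<^esub> c \<longleftrightarrow> t v \<in> verts (S c)" if "v \<in> verts G - C" "c \<in> C" for v c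
  proof -
    have "v \<rightarrow>\<^bsub>G\<^esub> c \<longleftrightarrow> verts (S c) \<inter> verts (S v) \<noteq> {}"
      using subtree_representation_adj_iff[OF assms(2), of v c] C that by (auto simp: Int_commute)
    with subtree_at_meets_iff[OF Sc t] that show ?thesis by auto
  qed
  \<comment> \<open>A value in \<open>C\<close> encodes that the leaf imposes no condition.\<close>
  define F where "F g = {c \<in> C. \<forall>l\<in>leaves T. g l \<notin> C \<longrightarrow> g l \<rightarrow>\<^bsub>G\<^esub> c}" for g
  have "anchor_sets G C \<subseteq> F ` (leaves T \<rightarrow>\<^sub>E verts G)"
  proof
    fix A assume "A \<in> anchor_sets G C"
    then obtain M where M: "M \<subseteq> periphery G C" and A: "A = anchor_set G M C"
      by (auto simp: anchor_sets_def)
    have MV: "M \<subseteq> verts G - C"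
      using M by (auto simp: periphery_def joint_neighbors_def neighbors_def dest: G.adj_in_verts)
    then have "finite M" using finite_subset G.finite_verts by blast
    have A_eq: "A = {c \<in> C. \<forall>v\<in>M. v \<rightarrow>\<^bsub>G\<^esub> c}"
      using A C by (auto simp: anchor_set_def common_neighbors_def neighbors_def)
    \<comment> \<open>The members of \<open>M\<close> whose topmost node lies on the path from the
      root to \<open>l\<close>. Among them \<open>f l\<close> has the deepest top; the default
      \<open>c0\<close>, a member of \<open>C\<close>, marks an empty \<open>P l\<close>.\<close>
    define P where "P l = {v \<in> M. (l, t v) \<in> up\<^sup>*}" for l
    have "\<exists>w. if P l = {} then w = c0 else w \<in> P l \<and> (\<forall>v\<in>P l. level (t v) \<le> level (t w))" for l
      using finite_ex_max_nat[of "P l" "level \<circ> t"] \<open>finite M\<close> by (auto simp: P_def)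
    then obtain f where f:
      "\<And>l. if P l = {} then f l = c0 else f l \<in> P l \<and> (\<forall>v\<in>P l. level (t v) \<le> level (t (f l)))"
      by metis
    define g where "g = restrict f (leaves T)"
    have "f l \<in> verts G" for l
      using f[of l] MV C c0 by (auto simp: P_def split: if_splits)
    then have "g \<in> leaves T \<rightarrow>\<^sub>E verts G" by (simp add: g_def)
    moreover have "A = F g"
    proof
      show "A \<subseteq> F g"
      proof
        fix c assume c: "c \<in> A"
        have "f l \<rightarrow>\<^bsub>G\<^esub> c" if "f l \<notin> C" for l
          using f[of l] that c c0 by (auto simp: A_eq P_def split: if_splits)
        with c show "c \<in> F g" by (auto simp: F_def g_def A_eq)
      qed
      show "F g \<subseteq> A"
      proof
        fix c assume c: "c \<in> F g"
        then have "c \<in> C" by (simp add: F_def)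
        have "v \<rightarrow>\<^bsub>G\<^esub> c" if v: "v \<in> M" for v
        proof (cases "t v = r")
          \<comment> \<open>A top at the root lies in every clique subtree, so \<open>v\<close>
            excludes no \<open>c\<close>. This case needs no leaf, and a one-node tree has
            none.\<close>
          case True
          then show ?thesis using adj_iff[of v c] v MV \<open>c \<in> C\<close> r(2) by auto
        next
          case False
          have "t v \<in> verts T" using t[of v] v MV by (auto simp: subtree_at_def)
          with False obtain l where l: "l \<in> leaves T" "(l, t v) \<in> up\<^sup>*"
            using leaf_below by blast
          then have "v \<in> P l" using v by (simp add: P_def)
          with f[of l] have w: "f l \<in> M" "(l, t (f l)) \<in> up\<^sup>*" "level (t v) \<le> level (t (f l))"
            by (auto simp: P_def split: if_splits)
          \<comment> \<open>Both tops lie on the path from \<open>l\<close> to the root, and that of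
            \<open>f l\<close> is at least as deep, so the condition imposed by \<open>f l\<close>
            implies the one imposed by \<open>v\<close>.\<close>
          then have above: "(t (f l), t v) \<in> up\<^sup>*"
            using up_linear[OF l(2) w(2)] up_rtrancl_depth[of "t v" "t (f l)"] by auto
          have "f l \<rightarrow>\<^bsub>G\<^esub> c" using c l(1) w(1) MV by (auto simp: F_def g_def)
          then have "t (f l) \<in> verts (S c)" using adj_iff w(1) MV \<open>c \<in> C\<close> by auto
          then have "t v \<in> verts (S c)"
            using subtree_at_root_closed[OF Sc[OF \<open>c \<in> C\<close>]] above by blast
          then show ?thesis using adj_iff v MV \<open>c \<in> C\<close> by auto
        qed
        with \<open>c \<in> C\<close> show "c \<in> A" by (simp add: A_eq)
      qed
    qed
    ultimately show "A \<in> F ` (leaves T \<rightarrow>\<^sub>E verts G)" by blast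
  qed
  moreover have fin: "finite (leaves T)" by (simp add: leaves_def)
  ultimately have "card (anchor_sets G C) \<le> card (leaves T \<rightarrow>\<^sub>E verts G)"
    by (intro surj_card_le finite_PiE) auto
  also have "\<dots> = card (verts G) ^ card (leaves T)" using fin by (simp add: card_PiE)
  finally show ?thesis .
qed

section \<open>Simplicial vertices of chordal graphs\<close>

lemma successively_nth:
  "successively P xs \<Longrightarrow> Suc i < length xs \<Longrightarrow> P (xs ! i) (xs ! Suc i)"
proof (induct xs arbitrary: i)
  case (Cons x xs)
  then show ?case by (cases i; cases xs) auto
qed simp

context graph
begin

lemma induced_cycle_Cons:
  assumes p: "distinct p" "2 \<le> length p" "set p \<subseteq> verts G" "successively (dominates G) p"
    and chordless: "\<And>i j. Suc i < j \<Longrightarrow> j < length p \<Longrightarrow> \<not> p ! i \<rightarrow>\<^bsub>G\<^esub> p ! j"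
    and x: "x \<in> verts G" "x \<notin> set p"
    and x_adj: "\<And>i. i < length p \<Longrightarrow> x \<rightarrow>\<^bsub>G\<^esub> p ! i \<longleftrightarrow> i = 0 \<or> Suc i = length p"
  shows "induced_cycle G (x # p)"
proof -
  have p_adj: "p ! i \<rightarrow>\<^bsub>G\<^esub> p ! j \<longleftrightarrow> j = Suc i \<or> i = Suc j"
    if "i < length p" "j < length p" for i j
    using that successively_nth[OF p(4), of i] successively_nth[OF p(4), of j]
      chordless[of i j] chordless[of j i] dominates_commute[of "p ! i" "p ! j"]
      dominates_irrefl[of "p ! i"]
    by (cases "i = j"; cases "Suc i = j"; cases "i = Suc j"; cases "i < j") auto
  have adj_iff: "(x # p) ! i \<rightarrow>\<^bsub>G\<^esub> (x # p) ! j \<longleftrightarrow>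
      j = Suc i mod length (x # p) \<or> i = Suc j mod length (x # p)"
    if "i < length (x # p)" "j < length (x # p)" for i j
  proof -
    \<comment> \<open>Position 0 is \<open>x\<close> and position \<open>Suc k\<close> is
      \<open>p ! k\<close>; the modulus only sends the last position, \<open>length p\<close>, back
      to 0.\<close>
    have mod_eq: "Suc k mod length (x # p) = (if k = length p then 0 else Suc k)"
      if "k < length (x # p)" for k using that by simp
    show ?thesis
      unfolding mod_eq[OF that(1)] mod_eq[OF that(2)]
    proof (cases i)
      case i: 0
      show "(x # p) ! i \<rightarrow>\<^bsub>G\<^esub> (x # p) ! j \<longleftrightarrow> j = (if i = length p then 0 else Suc i) \<or>
        i = (if j = length p then 0 else Suc j)"
        using i that p(2) dominates_irrefl[of x] x_adj[of "j - 1"] by (cases j) auto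
    next
      case i: (Suc i')
      show "(x # p) ! i \<rightarrow>\<^bsub>G\<^esub> (x # p) ! j \<longleftrightarrow> j = (if i = length p then 0 else Suc i) \<or>
        i = (if j = length p then 0 else Suc j)"
      proof (cases j)
        case 0
        with i that x_adj[of i'] p(2) dominates_commute[of x "p ! i'"] show ?thesis by auto
      next
        case (Suc j')
        with i that have ij: "i' < length p" "j' < length p" by simp_all
        then have "j = (if i = length p then 0 else Suc i) \<or> i = (if j = length p then 0 else Suc j)
          \<longleftrightarrow> j' = Suc i' \<or> i' = Suc j'" unfolding i Suc by auto
        with p_adj[OF ij] show ?thesis unfolding i Suc by simp
      qed
    qed
  qed
  have "3 \<le> length (x # p)" "distinct (x # p)" "set (x # p) \<subseteq> verts G" using p x by auto
  with adj_iff show ?thesis unfolding induced_cycle_def by blast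
qed

text \<open>Relative to a vertex set \<open>W\<close>, so that inductions run over subsets of one
  fixed graph instead of over induced subgraphs.\<close>

definition simplicial_in :: "'a set \<Rightarrow> 'a \<Rightarrow> bool" where
  "simplicial_in W y \<longleftrightarrow>
     (\<forall>a\<in>W. \<forall>b\<in>W. y \<rightarrow>\<^bsub>G\<^esub> a \<and> y \<rightarrow>\<^bsub>G\<^esub> b \<and> a \<noteq> b \<longrightarrow> a \<rightarrow>\<^bsub>G\<^esub> b)"

lemma complete_simplicial_in:
  "(\<And>a b. a \<in> W \<Longrightarrow> b \<in> W \<Longrightarrow> b \<noteq> a \<Longrightarrow> a \<rightarrow>\<^bsub>G\<^esub> b) \<Longrightarrow> simplicial_in W y"
  unfolding simplicial_in_def by metis

text \<open>Otherwise a chordless path from \<open>u\<close> to \<open>v\<close> with interior in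
  \<open>Y\<close> has at least three vertices, and \<open>x\<close>, adjacent to its ends only,
  closes it to an induced cycle of length at least 4.\<close>

lemma chordal_separator_adj:
  assumes "chordal G" "Y \<subseteq> verts G"
    and x: "x \<notin> Y" "\<And>y. y \<in> Y \<Longrightarrow> \<not> x \<rightarrow>\<^bsub>G\<^esub> y"
    and u: "x \<rightarrow>\<^bsub>G\<^esub> u" "u \<rightarrow>\<^bsub>G\<^esub> a" and v: "x \<rightarrow>\<^bsub>G\<^esub> v" "v \<rightarrow>\<^bsub>G\<^esub> b"
    and ab: "(a, b) \<in> rtrancl_on Y (arcs_ends G)" and "u \<noteq> v"
  shows "u \<rightarrow>\<^bsub>G\<^esub> v"
proof (rule ccontr)
  assume nadj: "\<not> u \<rightarrow>\<^bsub>G\<^esub> v"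
  let ?X = "Y \<union> {u, v}"
  have "a \<in> Y" "b \<in> Y" using in_rtrancl_on_in_F[OF ab] .
  have "(a, b) \<in> rtrancl_on ?X (arcs_ends G)" by (rule rtrancl_on_mono[OF _ _ ab]) auto
  then have "(a, v) \<in> rtrancl_on ?X (arcs_ends G)"
    by (rule rtrancl_on_into_rtrancl_on) (use v dominates_commute in auto)
  then have "(u, v) \<in> rtrancl_on ?X {(a, b). a \<rightarrow>\<^bsub>G\<^esub> b}"
    using u by (simp add: converse_rtrancl_on_into_rtrancl_on)
  then obtain p where p: "walk_in (dominates G) ?X u p v" "distinct p"
    and chordless: "\<And>i j. Suc i < j \<Longrightarrow> j < length p \<Longrightarrow> \<not> p ! i \<rightarrow>\<^bsub>G\<^esub> p ! j"
    by (rule chordless_path) blast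
  have pne: "p \<noteq> []" "p ! 0 = u" "p ! (length p - 1) = v" "set p \<subseteq> ?X"
    "successively (dominates G) p"
    using p(1) by (auto simp: walk_in_def hd_conv_nth last_conv_nth)
  have "length p \<noteq> 1" using pne \<open>u \<noteq> v\<close> by auto
  moreover have "length p \<noteq> 2" using pne nadj successively_nth[OF pne(5), of 0] by auto
  moreover have "length p \<noteq> 0" using pne(1) by simp
  ultimately have len: "3 \<le> length p" by linarith
  have "induced_cycle G (x # p)"
  proof (rule induced_cycle_Cons)
    show "set p \<subseteq> verts G" using pne(4) assms(2) u v by (auto dest: adj_in_verts)
    show "x \<in> verts G" using u(1) by (rule adj_in_verts)
    show "x \<notin> set p" using pne(4) x(1) u v dominates_irrefl by blast
    show "x \<rightarrow>\<^bsub>G\<^esub> p ! i \<longleftrightarrow> i = 0 \<or> Suc i = length p" if i: "i < length p" for i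
    proof (cases "i = 0 \<or> Suc i = length p")
      case True
      then have "p ! i = u \<or> p ! i = v" using pne(2,3) by (metis diff_Suc_1)
      with True u v show ?thesis by auto
    next
      case False
      have "p ! i \<noteq> p ! 0" "p ! i \<noteq> p ! (length p - 1)"
        using False i len nth_eq_iff_index_eq[OF p(2) i, of 0]
          nth_eq_iff_index_eq[OF p(2) i, of "length p - 1"] by fastforce+
      then have "p ! i \<in> Y" using pne(2-4) nth_mem[OF i] by blast
      with x(2) False show ?thesis by blast
    qed
  qed (use p pne len chordless in auto)
  with assms(1) len show False unfolding chordal_def by force
qed

text \<open>Let \<open>A\<close> be a component of the non-neighbours of \<open>x\<close> and \<open>S\<close> its neighbourhood. A chordless
  path through \<open>A\<close> between two non-adjacent vertices of \<open>S\<close> would close to a hole at \<open>x\<close>, so \<open>S\<close>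
  is a clique; hence one can induct on \<open>A \<union> S\<close>, steering the simplicial vertex into \<open>A\<close>.\<close>

lemma chordal_simplicial_nonneighbour:
  assumes "chordal G" "W \<subseteq> verts G" "x \<in> W" "w \<in> W" "w \<noteq> x" "\<not> x \<rightarrow>\<^bsub>G\<^esub> w"
  shows "\<exists>y\<in>W. y \<noteq> x \<and> \<not> x \<rightarrow>\<^bsub>G\<^esub> y \<and> simplicial_in W y"
  using assms(2-)
proof (induct "card W" arbitrary: W x w rule: less_induct)
  case less
  define Y where "Y = {y \<in> W. y \<noteq> x \<and> \<not> x \<rightarrow>\<^bsub>G\<^esub> y}"
  define A where "A = {y. (w, y) \<in> rtrancl_on Y (arcs_ends G)}"
  define S where "S = {s \<in> W - Y. \<exists>a\<in>A. s \<rightarrow>\<^bsub>G\<^esub> a}"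
  have "Y \<subseteq> verts G" using less(2) by (auto simp: Y_def)
  have "A \<subseteq> Y" using in_rtrancl_on_in_F(2) by (auto simp: A_def)
  have "w \<in> A" using less by (auto simp: A_def Y_def)
  \<comment> \<open>Outside \<open>Y\<close>, \<open>s\<close> is \<open>x\<close> or a neighbour of
    \<open>x\<close>; it is not \<open>x\<close>, because it has a neighbour in \<open>A\<close> and
    \<open>A\<close> has no neighbour of \<open>x\<close>.\<close>
  have S_adj: "x \<rightarrow>\<^bsub>G\<^esub> s" if "s \<in> S" for s
    using that \<open>A \<subseteq> Y\<close> dominates_commute by (auto simp: S_def Y_def)
  have S_clique: "u \<rightarrow>\<^bsub>G\<^esub> v" if uv: "u \<in> S" "v \<in> S" "u \<noteq> v" for u v
  proof -
    obtain a b where ab: "a \<in> A" "b \<in> A" "u \<rightarrow>\<^bsub>G\<^esub> a" "v \<rightarrow>\<^bsub>G\<^esub> b" using uv by (auto simp: S_def)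
    have "x \<rightarrow>\<^bsub>G\<^esub> u" "x \<rightarrow>\<^bsub>G\<^esub> v" using uv S_adj by blast+
    moreover have "x \<notin> Y" "\<And>y. y \<in> Y \<Longrightarrow> \<not> x \<rightarrow>\<^bsub>G\<^esub> y" by (simp_all add: Y_def)
    moreover have "sym (rtrancl_on Y (arcs_ends G))"
      using sym_arcs unfolding symmetric_def by (rule rtrancl_on_sym)
    then have "(a, b) \<in> rtrancl_on Y (arcs_ends G)"
      using ab(1,2) rtrancl_on_trans unfolding A_def by (metis mem_Collect_eq symD)
    ultimately show ?thesis
      using chordal_separator_adj[OF assms(1) \<open>Y \<subseteq> verts G\<close>, of x u a v b] ab(3,4) uv(3)
      by blast
  qed
  \<comment> \<open>\<open>A \<union> S\<close> contains all neighbours in \<open>W\<close> of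
    vertices of \<open>A\<close>, so a vertex of \<open>A\<close> simplicial in
    \<open>A \<union> S\<close> is simplicial in \<open>W\<close>.\<close>
  have nb: "b \<in> A \<union> S" if "a \<in> A" "b \<in> W" "a \<rightarrow>\<^bsub>G\<^esub> b" for a b
  proof (cases "b \<in> Y")
    case True
    with that have "b \<in> A" by (auto simp: A_def intro: rtrancl_on_into_rtrancl_on)
    then show ?thesis ..
  next
    case False
    with that dominates_commute have "b \<in> S" by (auto simp: S_def)
    then show ?thesis ..
  qed
  have lift: ?case if "y \<in> A" "simplicial_in (A \<union> S) y" for y
  proof -
    have "simplicial_in W y" using that nb unfolding simplicial_in_def by blast
    moreover have "y \<in> Y" using that \<open>A \<subseteq> Y\<close> by blast
    ultimately show ?thesis by (auto simp: Y_def)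
  qed
  have sub: "A \<union> S \<subseteq> W" using \<open>A \<subseteq> Y\<close> by (auto simp: Y_def S_def)
  have "x \<notin> A \<union> S" using \<open>A \<subseteq> Y\<close> S_adj dominates_irrefl by (auto simp: Y_def)
  with sub less(3) have "A \<union> S \<subset> W" by blast
  moreover have "finite W" using less(2) finite_verts by (rule finite_subset)
  ultimately have "card (A \<union> S) < card W" by (simp add: psubset_card_mono)
  moreover have "A \<union> S \<subseteq> verts G" using sub less(2) by blast
  ultimately have IH: "\<exists>y\<in>A \<union> S. y \<noteq> z \<and> \<not> z \<rightarrow>\<^bsub>G\<^esub> y \<and> simplicial_in (A \<union> S) y"
    if "z \<in> A \<union> S" "z' \<in> A \<union> S" "z' \<noteq> z" "\<not> z \<rightarrow>\<^bsub>G\<^esub> z'" for z z'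
    using less(1) that by blast
  show ?case
  proof (cases "\<exists>z\<in>S. \<exists>z'\<in>A \<union> S. z' \<noteq> z \<and> \<not> z \<rightarrow>\<^bsub>G\<^esub> z'")
    \<comment> \<open>The simplicial vertex obtained is not adjacent to \<open>z\<close> in the
      clique \<open>S\<close>, so it lies in \<open>A\<close>.\<close>
    case True
    then obtain z y where "z \<in> S" "y \<in> A \<union> S" "y \<noteq> z" "\<not> z \<rightarrow>\<^bsub>G\<^esub> y" "simplicial_in (A \<union> S) y"
      using IH by blast
    then show ?thesis using lift S_clique by blast
  next
    \<comment> \<open>Now each vertex of \<open>S\<close> is adjacent to all others of
      \<open>A \<union> S\<close>, so any vertex with a non-neighbour there lies in
      \<open>A\<close>.\<close>
    case universal: False
    show ?thesis
    proof (cases "\<exists>z\<in>A \<union> S. \<exists>z'\<in>A \<union> S. z' \<noteq> z \<and> \<not> z \<rightarrow>\<^bsub>G\<^esub> z'")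
      case True
      then obtain z y where
        zy: "z \<in> A \<union> S" "y \<in> A \<union> S" "y \<noteq> z" "\<not> y \<rightarrow>\<^bsub>G\<^esub> z" "simplicial_in (A \<union> S) y"
        using IH by (metis dominates_commute)
      with universal have "y \<notin> S" by metis
      with zy show ?thesis using lift by blast
    next
      case False
      then have "simplicial_in (A \<union> S) w" by (intro complete_simplicial_in) auto
      with \<open>w \<in> A\<close> show ?thesis by (rule lift)
    qed
  qed
qed

lemma chordal_simplicial_vertex:
  assumes "chordal G" "W \<subseteq> verts G" "W \<noteq> {}"
  shows "\<exists>y\<in>W. simplicial_in W y"
proof (cases "\<exists>x\<in>W. \<exists>w\<in>W. w \<noteq> x \<and> \<not> x \<rightarrow>\<^bsub>G\<^esub> w")
  case True
  then show ?thesis using chordal_simplicial_nonneighbour[OF assms(1,2)] by blast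
next
  case False
  then have "simplicial_in W y" for y by (intro complete_simplicial_in) auto
  then show ?thesis using assms(3) by blast
qed

end

section \<open>Subtree representations of chordal graphs\<close>

text \<open>Each parent edge is stored in both orientations. Arcs are pairs of nodes, as in the host
  trees over which \<open>leafage\<close> minimizes.\<close>

definition parent_graph :: "'a set \<Rightarrow> 'a \<Rightarrow> ('a \<Rightarrow> 'a) \<Rightarrow> ('a, 'a \<times> 'a) pre_digraph" where
  "parent_graph V r par =
     \<lparr>verts = V, arcs = (\<lambda>x. (x, par x)) ` (V - {r}) \<union> (\<lambda>x. (par x, x)) ` (V - {r}),
      tail = fst, head = snd\<rparr>"

context rooted_tree
begin

lemma parent_graph_simps:
  "verts (parent_graph V r par) = V" "arcs_ends (parent_graph V r par) = up \<union> up\<inverse>"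
  by (auto simp: parent_graph_def arcs_ends_conv up_def image_Un image_image)

lemma graph_parent_graph: "graph (parent_graph V r par)"
proof -
  interpret digraph "parent_graph V r par"
    by unfold_locales
      (use finite_V par_in depth_par in \<open>force simp: parent_graph_def arc_to_ends_def\<close>)+
  have "symmetric (parent_graph V r par)"
    by (auto simp: symmetric_def parent_graph_simps sym_def)
  then show ?thesis by (rule graphI)
qed

lemma connected_parent_graph: "connected (parent_graph V r par)"
proof -
  interpret graph "parent_graph V r par" by (rule graph_parent_graph)
  have root: "x \<rightarrow>\<^sup>*\<^bsub>parent_graph V r par\<^esub> r" if "x \<in> V" for x
  proof -
    have "(x, r) \<in> up\<^sup>*" by (rule subtree_at_up_top[OF subtree_at_V that])
    then have "(x, r) \<in> (arcs_ends (parent_graph V r par))\<^sup>*"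
      by (rule rev_subsetD[OF _ rtrancl_mono]) (simp add: parent_graph_simps)
    then show ?thesis using that root_in by (simp add: reachable_conv parent_graph_simps)
  qed
  have "x \<rightarrow>\<^sup>*\<^bsub>parent_graph V r par\<^esub> y" if "x \<in> V" "y \<in> V" for x y
    using root[OF that(1)] root[OF that(2)] symmetric_reachable' reachable_trans by blast
  then show ?thesis
    using root_in
    by (auto simp: connected_def strongly_connected_def parent_graph_simps
        intro!: reachable_mk_symmetricI)
qed

text \<open>The two neighbours on a cycle of a deepest vertex would both be its parent.\<close>

lemma acyclic_parent_graph:
  "\<not> (\<exists>p. pre_digraph.cycle (parent_graph V r par) p \<and> 3 \<le> length p)"
proof
  interpret graph "parent_graph V r par" by (rule graph_parent_graph)
  assume "\<exists>p. pre_digraph.cycle (parent_graph V r par) p \<and> 3 \<le> length p"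
  then obtain c where c: "distinct c" "3 \<le> length c"
    "successively (dominates (parent_graph V r par)) c" "last c \<rightarrow>\<^bsub>parent_graph V r par\<^esub> hd c"
    unfolding ex_cycle_iff by blast
  then obtain x where x: "x \<in> set c" and deepest: "\<And>y. y \<in> set c \<Longrightarrow> depth y \<le> depth x"
    using finite_ex_max_nat[of "set c" depth] by fastforce
  have eq_par: "y = par x"
    if "y \<in> set c" "x \<rightarrow>\<^bsub>parent_graph V r par\<^esub> y \<or> y \<rightarrow>\<^bsub>parent_graph V r par\<^esub> x" for y
    using that deepest[OF that(1)] depth_par[of y]
    by (auto simp: parent_graph_simps in_up_iff)
  obtain as bs where split: "c = as @ x # bs" using x by (meson split_list)
  show False
  \<comment> \<open>The deepest vertex \<open>x\<close> is first, last or in between; in the first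
    two cases one of its neighbours is found by wrapping around the list.\<close>
  proof (cases as rule: rev_cases)
    case Nil
    with split c(2) obtain b bs' where bs: "bs = b # bs'" "bs' \<noteq> []"
      by (cases bs; cases "tl bs") auto
    with Nil split c(3,4) have "b = par x" "last bs' = par x"
      by (auto intro!: eq_par)
    with c(1) split bs show False using last_in_set[of bs'] by auto
  next
    case (snoc as' a)
    then have a: "a = par x"
      using split c(3) by (auto simp: successively_append_iff intro!: eq_par)
    show False
    proof (cases bs)
      case Nil
      with snoc split c(2) have ne: "as' \<noteq> []" by auto
      with Nil snoc split c(4) have "hd as' = par x"
        by (auto intro!: eq_par)
      with a snoc split c(1) ne show False using hd_in_set[of as'] by auto
    next
      case (Cons b bs')
      then have "b = par x"
        using split c(3) by (auto simp: successively_append_iff intro!: eq_par)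
      with a snoc split Cons c(1) show False by auto
    qed
  qed
qed

lemma undirected_tree_parent_graph: "undirected_tree (parent_graph V r par)"
  unfolding undirected_tree_def
  using graph_parent_graph connected_parent_graph acyclic_parent_graph by blast

text \<open>Subtrees inherit \<open>par\<close> and \<open>depth\<close>, so what is shown about the
  host tree applies to them as well.\<close>

lemma rooted_tree_subtree_at:
  "subtree_at X t \<Longrightarrow> rooted_tree X t par depth"
  using finite_V depth_par by unfold_locales (auto simp: subtree_at_def intro: finite_subset)

lemma subgraph_parent_graph:
  assumes "subtree_at X t"
  shows "subgraph (parent_graph X t par) (parent_graph V r par)"
proof -
  interpret X: rooted_tree X t par depth using assms by (rule rooted_tree_subtree_at)
  interpret G: graph "parent_graph V r par" by (rule graph_parent_graph)
  interpret H: graph "parent_graph X t par" by (rule X.graph_parent_graph)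
  show ?thesis
    using assms G.wf_digraph H.wf_digraph
    by (auto simp: subgraph_def compatible_def parent_graph_def subtree_at_def)
qed

end

text \<open>Induction on \<open>W\<close>, removing a simplicial vertex \<open>v\<close>. Its
  neighbours form a clique, so their subtrees share a node \<open>x\<close>; a new node
  \<open>Suc m\<close> below \<open>x\<close> becomes the subtree of \<open>v\<close> and is added
  to the subtrees of its neighbours. Parents are smaller numbers, so \<open>id\<close> is a
  depth.\<close>

lemma (in graph) chordal_parent_representation:
  assumes "chordal G" "W \<subseteq> verts G"
  shows "\<exists>m par S t. rooted_tree {..m::nat} 0 par id \<and>
    (\<forall>v\<in>W. rooted_tree.subtree_at {..m} 0 par (S v) (t v)) \<and>
    (\<forall>u\<in>W. \<forall>v\<in>W. u \<noteq> v \<longrightarrow> (u \<rightarrow>\<^bsub>G\<^esub> v \<longleftrightarrow> S u \<inter> S v \<noteq> {}))"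
  using assms(2)
proof (induct "card W" arbitrary: W rule: less_induct)
  case less
  have fin: "finite W" using less(2) finite_verts by (rule finite_subset)
  show ?case
  proof (cases "W = {}")
    case True
    have "rooted_tree {..0::nat} 0 id id" by unfold_locales auto
    with True show ?thesis by blast
  next
    case False
    then obtain v where v: "v \<in> W" "simplicial_in W v"
      using chordal_simplicial_vertex[OF assms(1) less(2)] by blast
    let ?W = "W - {v}"
    have "card ?W < card W" using fin v(1) by (rule card_Diff1_less)
    moreover have "?W \<subseteq> verts G" using less(2) by blast
    ultimately have "\<exists>m par S t. rooted_tree {..m::nat} 0 par id \<and>
      (\<forall>u\<in>?W. rooted_tree.subtree_at {..m} 0 par (S u) (t u)) \<and>
      (\<forall>a\<in>?W. \<forall>b\<in>?W. a \<noteq> b \<longrightarrow> (a \<rightarrow>\<^bsub>G\<^esub> b \<longleftrightarrow> S a \<inter> S b \<noteq> {}))"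
      by (rule less(1))
    then obtain m par S t where T: "rooted_tree {..m::nat} 0 par id"
      and sub': "\<forall>u\<in>?W. rooted_tree.subtree_at {..m} 0 par (S u) (t u)"
      and adj': "\<forall>a\<in>?W. \<forall>b\<in>?W. a \<noteq> b \<longrightarrow> (a \<rightarrow>\<^bsub>G\<^esub> b \<longleftrightarrow> S a \<inter> S b \<noteq> {})"
      by (elim exE conjE)
    note sub = sub'[rule_format] and adj = adj'[rule_format]
    interpret rooted_tree "{..m}" 0 par id by (fact T)
    define K where "K = {u \<in> ?W. v \<rightarrow>\<^bsub>G\<^esub> u}"
    have ne: "S a \<inter> S a \<noteq> {}" if "a \<in> ?W" for a using sub[OF that] by (auto simp: subtree_at_def)
    obtain x where x: "x \<le> m" "\<And>u. u \<in> K \<Longrightarrow> x \<in> S u"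
    \<comment> \<open>Without neighbours of \<open>v\<close> the new node may hang anywhere, for
      instance at the root 0.\<close>
    proof (cases "K = {}")
      case True
      then show thesis using that[of 0] by simp
    next
      case False
      have "\<exists>x\<in>{..m}. \<forall>u\<in>K. x \<in> S u"
      proof (rule helly)
        show "finite K" using fin by (simp add: K_def)
        show "subtree_at (S u) (t u)" if "u \<in> K" for u using sub that by (simp add: K_def)
        show "S a \<inter> S b \<noteq> {}" if ab: "a \<in> K" "b \<in> K" for a b
        proof (cases "a = b")
          case True
          then show ?thesis using ne ab by (auto simp: K_def)
        next
          case False
          with ab v(2) have "a \<rightarrow>\<^bsub>G\<^esub> b" by (auto simp: K_def simplicial_in_def)
          with adj[of a b] ab False show ?thesis by (simp add: K_def)
        qed
      qed fact
      then show thesis using that by auto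
    qed
    define par' where "par' = par(Suc m := x)"
    define S' where "S' u = (if u = v then {Suc m} else if u \<in> K then insert (Suc m) (S u) else S u)" for u
    define t' where "t' u = (if u = v then Suc m else t u)" for u
    have T': "rooted_tree {..Suc m} 0 par' id"
      using x(1) par_in depth_par by unfold_locales (auto simp: par'_def le_Suc_eq)
    then interpret T': rooted_tree "{..Suc m}" 0 par' id .
    have S_le: "S u \<subseteq> {..m}" if "u \<in> ?W" for u using sub[OF that] by (simp add: subtree_at_def)
    have "T'.subtree_at (S' u) (t' u)" if "u \<in> W" for u
    proof (cases "u = v")
      case True
      then show ?thesis by (auto simp: T'.subtree_at_def S'_def t'_def)
    next
      case False
      with that have u: "u \<in> ?W" by simp
      have "par' y \<in> S' u" "y \<noteq> 0" if y: "y \<in> S' u" "y \<noteq> t u" for y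
        using y sub[OF u] S_le[OF u] x(2)[of u] False
        by (auto simp: S'_def par'_def subtree_at_def split: if_splits)
      moreover have "S' u \<subseteq> {..Suc m}" "t u \<in> S' u"
        using S_le[OF u] sub[OF u] False by (auto simp: S'_def subtree_at_def)
      ultimately show ?thesis using False by (auto simp: T'.subtree_at_def t'_def)
    qed
    moreover have "a \<rightarrow>\<^bsub>G\<^esub> b \<longleftrightarrow> S' a \<inter> S' b \<noteq> {}" if ab: "a \<in> W" "b \<in> W" "a \<noteq> b" for a b
    proof -
      have v_adj: "v \<rightarrow>\<^bsub>G\<^esub> u \<longleftrightarrow> Suc m \<in> S' u" if "u \<in> ?W" for u
        using S_le[OF that] that by (auto simp: S'_def K_def)
      consider "a = v" "b \<in> ?W" | "b = v" "a \<in> ?W" | "a \<in> ?W" "b \<in> ?W" using ab by blast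
      then show ?thesis
      proof cases
        case 1
        then show ?thesis using v_adj[of b] by (simp add: S'_def)
      next
        case 2
        then show ?thesis using v_adj[of a] dominates_commute[of a v] by (simp add: S'_def)
      next
        case 3
        show ?thesis
        \<comment> \<open>Only two members of \<open>K\<close> gain a common node, namely
          \<open>Suc m\<close>, and they are adjacent because \<open>v\<close> is simplicial; other
          intersections do not change.\<close>
        proof (cases "a \<in> K \<and> b \<in> K")
          case True
          then have "a \<rightarrow>\<^bsub>G\<^esub> b" using v(2) ab by (auto simp: K_def simplicial_in_def)
          with True 3 show ?thesis by (auto simp: S'_def)
        next
          case False
          then have "S' a \<inter> S' b = S a \<inter> S b"
            using S_le[OF 3(1)] S_le[OF 3(2)] 3 by (auto simp: S'_def)
          with adj[OF 3 ab(3)] show ?thesis by simp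
        qed
      qed
    qed
    ultimately show ?thesis
      by (intro exI[of _ "Suc m"] exI[of _ par'] exI[of _ S'] exI[of _ t'] conjI ballI impI T')
  qed
qed

lemma chordal_subtree_representation:
  assumes "graph G" "chordal G"
  shows "\<exists>(T :: (nat, nat \<times> nat) pre_digraph) S. subtree_representation G T S"
proof -
  interpret graph G by fact
  obtain m par S t where "rooted_tree {..m::nat} 0 par id"
    and sub: "\<And>v. v \<in> verts G \<Longrightarrow> rooted_tree.subtree_at {..m} 0 par (S v) (t v)"
    and adj: "\<And>u v. u \<in> verts G \<Longrightarrow> v \<in> verts G \<Longrightarrow> u \<noteq> v \<Longrightarrow> u \<rightarrow>\<^bsub>G\<^esub> v \<longleftrightarrow> S u \<inter> S v \<noteq> {}"
    using chordal_parent_representation[OF assms(2) order_refl] by blast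
  then interpret rooted_tree "{..m}" 0 par id by simp
  have "undirected_tree (parent_graph (S v) (t v) par)"
    "subgraph (parent_graph (S v) (t v) par) (parent_graph {..m} 0 par)" if "v \<in> verts G" for v
    using sub[OF that] subgraph_parent_graph
      rooted_tree.undirected_tree_parent_graph[OF rooted_tree_subtree_at] by blast+
  moreover have "verts (parent_graph (S v) (t v) par) = S v" for v
    by (simp add: parent_graph_def)
  ultimately have "subtree_representation G (parent_graph {..m} 0 par)
      (\<lambda>v. parent_graph (S v) (t v) par)"
    using undirected_tree_parent_graph adj by (simp add: subtree_representation_def)
  then show ?thesis by blast
qed

theorem theorem13:
  fixes G :: "('a, 'b) pre_digraph"
  assumes "graph G" and "chordal G"
  shows "anchor_width G \<le> card (verts G) ^ leafage G"
proof -
  \<comment> \<open>Existence of some representation makes the \<open>LEAST\<close> in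
    \<open>leafage\<close> an attained value, so that a host tree with exactly that many leaves can
    be fixed.\<close>
  have "\<exists>k. \<exists>(T :: (nat, nat \<times> nat) pre_digraph) S.
      subtree_representation G T S \<and> card (leaves T) = k"
    using chordal_subtree_representation[OF assms] by blast
  then have "\<exists>(T :: (nat, nat \<times> nat) pre_digraph) S.
      subtree_representation G T S \<and> card (leaves T) = leafage G"
    unfolding leafage_def by (rule LeastI_ex)
  then obtain T :: "(nat, nat \<times> nat) pre_digraph" and S
    where T: "subtree_representation G T S" "card (leaves T) = leafage G" by blast
  have "\<forall>C. clique G C \<longrightarrow> card (anchor_sets G C) \<le> card (verts G) ^ leafage G"
    using card_anchor_sets_le[OF assms(1) T(1)] T(2) by simp
  then show ?thesis unfolding anchor_width_def by (rule Least_le)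
qed

end
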